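(* Let $\mathcal{C}$ be a preregular category in which every object is projective. Then every presheaf $\mathcal{C}^{\mathrm{op}}\to\mathsf{Set}$ is a sheaf for the regular topology on $\mathcal{C}$.
   Context: A morphism $f\colon Y\to X$ is an effective epimorphism if for every $e\colon Y\to W$ such that $e\circ g_1=e\circ g_2$ for all $g_1,g_2\colon Z\to Y$ with $f\circ g_1=f\circ g_2$, there is a unique $d\colon X\to W$ with $d\circ f=e$. A category is preregular if for every effective epimorphism $g\colon Z\to Y$ and every morphism $f\colon X\to Y$ there exist an effective epimorphism $h\colon W\to X$ and a morphism $i\colon W\to Z$ with $g\circ i=f\circ h$. The regular topology on a preregular category is the smallest Grothendieck topology in which, for each effective epimorphism $f$, the sieve generated by $f$ is a covering sieve. An object $P$ is projective if every morphism out of $P$ lifts along every epimorphism with the same target. *)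

theory Defs
  imports Main
begin

section \<open>Categories\<close>

text \<open>Composition is only meaningful on arrows \<open>g\<close>, \<open>f\<close> with \<open>Cod f = Dom g\<close>, and is
  written in applicative order (\<open>g \<cdot> f\<close> is \<open>g\<close> after \<open>f\<close>).\<close>

record ('o, 'm) category_data =
  Obj :: "'o set"
  Arr :: "'m set"
  Dom :: "'m \<Rightarrow> 'o"
  Cod :: "'m \<Rightarrow> 'o"
  Ident :: "'o \<Rightarrow> 'm"
  Comp :: "'m \<Rightarrow> 'm \<Rightarrow> 'm" (infixl "\<cdot>\<index>" 70)

definition hom_set :: "('o, 'm, 'e) category_data_scheme \<Rightarrow> 'o \<Rightarrow> 'o \<Rightarrow> 'm set" where
  "hom_set C X Y = {f \<in> Arr C. Dom C f = X \<and> Cod C f = Y}"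

locale category =
  fixes C :: "('o, 'm, 'e) category_data_scheme" (structure)
  assumes dom_obj: "f \<in> Arr C \<Longrightarrow> Dom C f \<in> Obj C"
    and cod_obj: "f \<in> Arr C \<Longrightarrow> Cod C f \<in> Obj C"
    and ident_hom: "X \<in> Obj C \<Longrightarrow> Ident C X \<in> hom_set C X X"
    and comp_hom: "f \<in> hom_set C X Y \<Longrightarrow> g \<in> hom_set C Y Z \<Longrightarrow> g \<cdot> f \<in> hom_set C X Z"
    and ident_left: "f \<in> hom_set C X Y \<Longrightarrow> Ident C Y \<cdot> f = f"
    and ident_right: "f \<in> hom_set C X Y \<Longrightarrow> f \<cdot> Ident C X = f"
    and comp_assoc: "f \<in> hom_set C W X \<Longrightarrow> g \<in> hom_set C X Y \<Longrightarrow> h \<in> hom_set C Y Z \<Longrightarrow>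
      (h \<cdot> g) \<cdot> f = h \<cdot> (g \<cdot> f)"

section \<open>Epimorphisms, effective epimorphisms, projectives\<close>

definition epimorphism :: "('o, 'm, 'e) category_data_scheme \<Rightarrow> 'm \<Rightarrow> bool" where
  "epimorphism C f \<longleftrightarrow> f \<in> Arr C \<and>
    (\<forall>W. \<forall>a \<in> hom_set C (Cod C f) W. \<forall>b \<in> hom_set C (Cod C f) W.
      a \<cdot>\<^bsub>C\<^esub> f = b \<cdot>\<^bsub>C\<^esub> f \<longrightarrow> a = b)"

definition effective_epimorphism :: "('o, 'm, 'e) category_data_scheme \<Rightarrow> 'm \<Rightarrow> bool" where
  "effective_epimorphism C f \<longleftrightarrow> f \<in> Arr C \<and>
    (\<forall>W. \<forall>e \<in> hom_set C (Dom C f) W.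
      (\<forall>Z. \<forall>g1 \<in> hom_set C Z (Dom C f). \<forall>g2 \<in> hom_set C Z (Dom C f).
        f \<cdot>\<^bsub>C\<^esub> g1 = f \<cdot>\<^bsub>C\<^esub> g2 \<longrightarrow> e \<cdot>\<^bsub>C\<^esub> g1 = e \<cdot>\<^bsub>C\<^esub> g2) \<longrightarrow>
      (\<exists>!d. d \<in> hom_set C (Cod C f) W \<and> d \<cdot>\<^bsub>C\<^esub> f = e))"

definition projective :: "('o, 'm, 'e) category_data_scheme \<Rightarrow> 'o \<Rightarrow> bool" where
  "projective C P \<longleftrightarrow> P \<in> Obj C \<and>
    (\<forall>p. epimorphism C p \<longrightarrow>
      (\<forall>f \<in> hom_set C P (Cod C p). \<exists>g \<in> hom_set C P (Dom C p). p \<cdot>\<^bsub>C\<^esub> g = f))"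

locale preregular_category = category +
  assumes preregular:
    "effective_epimorphism C g \<Longrightarrow> f \<in> hom_set C X (Cod C g) \<Longrightarrow>
      \<exists>W. \<exists>h \<in> hom_set C W X. \<exists>i \<in> hom_set C W (Dom C g).
        effective_epimorphism C h \<and> g \<cdot> i = f \<cdot> h"

section \<open>Sieves and Grothendieck topologies\<close>

definition sieve :: "('o, 'm, 'e) category_data_scheme \<Rightarrow> 'o \<Rightarrow> 'm set \<Rightarrow> bool" where
  "sieve C X S \<longleftrightarrow> S \<subseteq> {f \<in> Arr C. Cod C f = X} \<and>
    (\<forall>f \<in> S. \<forall>Z. \<forall>g \<in> hom_set C Z (Dom C f). f \<cdot>\<^bsub>C\<^esub> g \<in> S)"

definition maximal_sieve :: "('o, 'm, 'e) category_data_scheme \<Rightarrow> 'o \<Rightarrow> 'm set" where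
  "maximal_sieve C X = {f \<in> Arr C. Cod C f = X}"

definition pullback_sieve :: "('o, 'm, 'e) category_data_scheme \<Rightarrow> 'm \<Rightarrow> 'm set \<Rightarrow> 'm set" where
  "pullback_sieve C h S = {g \<in> Arr C. Cod C g = Dom C h \<and> h \<cdot>\<^bsub>C\<^esub> g \<in> S}"

definition generated_sieve :: "('o, 'm, 'e) category_data_scheme \<Rightarrow> 'm \<Rightarrow> 'm set" where
  "generated_sieve C f = {f \<cdot>\<^bsub>C\<^esub> g | g. g \<in> Arr C \<and> Cod C g = Dom C f}"

text \<open>\<open>J X\<close> is the set of covering sieves on the object \<open>X\<close>; its value at arguments outside
  \<open>Obj C\<close> is irrelevant.\<close>

definition grothendieck_topology ::
    "('o, 'm, 'e) category_data_scheme \<Rightarrow> ('o \<Rightarrow> 'm set set) \<Rightarrow> bool" where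
  "grothendieck_topology C J \<longleftrightarrow>
    (\<forall>X \<in> Obj C. \<forall>S \<in> J X. sieve C X S) \<and>
    (\<forall>X \<in> Obj C. maximal_sieve C X \<in> J X) \<and>
    (\<forall>X \<in> Obj C. \<forall>S \<in> J X. \<forall>Y. \<forall>h \<in> hom_set C Y X. pullback_sieve C h S \<in> J Y) \<and>
    (\<forall>X \<in> Obj C. \<forall>S \<in> J X. \<forall>R. sieve C X R \<longrightarrow>
      (\<forall>f \<in> S. pullback_sieve C f R \<in> J (Dom C f)) \<longrightarrow> R \<in> J X)"

definition effective_epis_cover ::
    "('o, 'm, 'e) category_data_scheme \<Rightarrow> ('o \<Rightarrow> 'm set set) \<Rightarrow> bool" where
  "effective_epis_cover C J \<longleftrightarrow>
    (\<forall>f. effective_epimorphism C f \<longrightarrow> generated_sieve C f \<in> J (Cod C f))"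

text \<open>The smallest topology in which effective epimorphisms cover is realised as the
  intersection of all such topologies; that it is one of them, and the least, is proved below.\<close>

definition regular_topology ::
    "('o, 'm, 'e) category_data_scheme \<Rightarrow> 'o \<Rightarrow> 'm set set" where
  "regular_topology C X =
    (\<Inter>J \<in> {J. grothendieck_topology C J \<and> effective_epis_cover C J}. J X)"

lemma (in category) sieve_generated_sieve:
  assumes "f \<in> Arr C"
  shows "sieve C (Cod C f) (generated_sieve C f)"
  unfolding sieve_def
proof (intro conjI ballI allI subsetI)
  fix k assume "k \<in> generated_sieve C f"
  then obtain g where g: "g \<in> hom_set C (Dom C g) (Dom C f)" "k = f \<cdot> g"
    by (auto simp: generated_sieve_def hom_set_def)
  have f: "f \<in> hom_set C (Dom C f) (Cod C f)"
    using assms by (simp add: hom_set_def)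
  have k: "k \<in> hom_set C (Dom C g) (Cod C f)"
    using comp_hom[OF g(1) f] g(2) by simp
  then show "k \<in> {f' \<in> Arr C. Cod C f' = Cod C f}"
    by (simp add: hom_set_def)
  fix Z h assume "h \<in> hom_set C Z (Dom C k)"
  then have h: "h \<in> hom_set C Z (Dom C g)"
    using k by (simp add: hom_set_def)
  have "k \<cdot> h = f \<cdot> (g \<cdot> h)"
    using comp_assoc[OF h g(1) f] g(2) by simp
  then show "k \<cdot> h \<in> generated_sieve C f"
    using comp_hom[OF h g(1)] by (auto simp: generated_sieve_def hom_set_def)
qed

lemma (in category) sieve_pullback_sieve:
  assumes "sieve C X S" and h: "h \<in> hom_set C Y X"
  shows "sieve C Y (pullback_sieve C h S)"
  unfolding sieve_def
proof (intro conjI ballI allI subsetI)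
  fix k assume "k \<in> pullback_sieve C h S"
  then have kS: "h \<cdot> k \<in> S" and k: "k \<in> hom_set C (Dom C k) Y"
    using h by (auto simp: pullback_sieve_def hom_set_def)
  then show "k \<in> {f \<in> Arr C. Cod C f = Y}"
    by (simp add: hom_set_def)
  fix Z g assume g: "g \<in> hom_set C Z (Dom C k)"
  have "Dom C (h \<cdot> k) = Dom C k"
    using comp_hom[OF k h] by (simp add: hom_set_def)
  then have "(h \<cdot> k) \<cdot> g \<in> S"
    using assms(1) kS g by (simp add: sieve_def)
  then show "k \<cdot> g \<in> pullback_sieve C h S"
    using comp_assoc[OF g k h] comp_hom[OF g k] h
    by (simp add: pullback_sieve_def hom_set_def)
qed

lemma (in category) grothendieck_topology_all_sieves:
  "grothendieck_topology C (\<lambda>X. {S. sieve C X S})"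
  unfolding grothendieck_topology_def mem_Collect_eq
proof (intro conjI ballI allI impI)
  fix X assume "X \<in> Obj C"
  show "sieve C X (maximal_sieve C X)"
    unfolding sieve_def
  proof (intro conjI ballI allI)
    fix f Z g assume f: "f \<in> maximal_sieve C X" and g: "g \<in> hom_set C Z (Dom C f)"
    have "f \<in> hom_set C (Dom C f) X"
      using f by (simp add: maximal_sieve_def hom_set_def)
    from comp_hom[OF g this] show "f \<cdot> g \<in> maximal_sieve C X"
      by (simp add: maximal_sieve_def hom_set_def)
  qed (simp add: maximal_sieve_def)
qed (blast intro: sieve_pullback_sieve)+

lemma regular_topology_iff:
  "S \<in> regular_topology C X \<longleftrightarrow>
    (\<forall>J. grothendieck_topology C J \<longrightarrow> effective_epis_cover C J \<longrightarrow> S \<in> J X)"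
  unfolding regular_topology_def by blast

lemma (in category) regular_topology_is_topology:
  "grothendieck_topology C (regular_topology C)"
proof -
  have "effective_epis_cover C (\<lambda>X. {S. sieve C X S})"
    unfolding effective_epis_cover_def mem_Collect_eq
    using sieve_generated_sieve unfolding effective_epimorphism_def by blast
  then have sieves: "sieve C X S" if "S \<in> regular_topology C X" for X S
    using that grothendieck_topology_all_sieves unfolding regular_topology_iff by blast
  show ?thesis
    unfolding grothendieck_topology_def
  proof (intro conjI ballI allI impI)
    fix X assume X: "X \<in> Obj C"
    show "maximal_sieve C X \<in> regular_topology C X"
      unfolding regular_topology_iff
      using X by (simp add: grothendieck_topology_def)
    fix S assume S: "S \<in> regular_topology C X"
    show "sieve C X S"
      using sieves S .
    show "pullback_sieve C h S \<in> regular_topology C Y" if h: "h \<in> hom_set C Y X" for Y h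
      unfolding regular_topology_iff
    proof (intro allI impI)
      fix J assume J: "grothendieck_topology C J" "effective_epis_cover C J"
      have "S \<in> J X"
        using S J unfolding regular_topology_iff by blast
      then show "pullback_sieve C h S \<in> J Y"
        using J(1) X h unfolding grothendieck_topology_def by blast
    qed
    show "R \<in> regular_topology C X" if R: "sieve C X R"
      and loc: "\<forall>f\<in>S. pullback_sieve C f R \<in> regular_topology C (Dom C f)" for R
      unfolding regular_topology_iff
    proof (intro allI impI)
      fix J assume J: "grothendieck_topology C J" "effective_epis_cover C J"
      have "S \<in> J X" "\<forall>f\<in>S. pullback_sieve C f R \<in> J (Dom C f)"
        using S loc J unfolding regular_topology_iff by blast+
      then show "R \<in> J X"
        using J(1) X R unfolding grothendieck_topology_def by blast
    qed
  qed
qed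

lemma regular_topology_covers: "effective_epis_cover C (regular_topology C)"
  unfolding effective_epis_cover_def regular_topology_iff by blast

lemma regular_topology_least:
  assumes "grothendieck_topology C J" "effective_epis_cover C J"
  shows "regular_topology C X \<subseteq> J X"
  using assms by (auto simp only: regular_topology_iff subset_iff)

section \<open>Presheaves and sheaves\<close>

text \<open>The sets \<open>Sections F X\<close> all live in one type \<open>'s\<close>, which is a free type variable and hence
  arbitrary; they need not be disjoint. \<open>Restr F f\<close> is only considered on \<open>Sections F (Cod C f)\<close>.\<close>

record ('o, 'm, 's) presheaf_data =
  Sections :: "'o \<Rightarrow> 's set"
  Restr :: "'m \<Rightarrow> 's \<Rightarrow> 's"

definition presheaf ::
    "('o, 'm, 'e) category_data_scheme \<Rightarrow> ('o, 'm, 's, 'p) presheaf_data_scheme \<Rightarrow> bool" where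
  "presheaf C F \<longleftrightarrow>
    (\<forall>f \<in> Arr C. \<forall>x \<in> Sections F (Cod C f). Restr F f x \<in> Sections F (Dom C f)) \<and>
    (\<forall>X \<in> Obj C. \<forall>x \<in> Sections F X. Restr F (Ident C X) x = x) \<and>
    (\<forall>X Y Z. \<forall>f \<in> hom_set C X Y. \<forall>g \<in> hom_set C Y Z. \<forall>x \<in> Sections F Z.
      Restr F (g \<cdot>\<^bsub>C\<^esub> f) x = Restr F f (Restr F g x))"

definition matching_family ::
    "('o, 'm, 'e) category_data_scheme \<Rightarrow> ('o, 'm, 's, 'p) presheaf_data_scheme \<Rightarrow>
      'm set \<Rightarrow> ('m \<Rightarrow> 's) \<Rightarrow> bool" where
  "matching_family C F S s \<longleftrightarrow>
    (\<forall>f \<in> S. s f \<in> Sections F (Dom C f)) \<and>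
    (\<forall>f \<in> S. \<forall>Z. \<forall>g \<in> hom_set C Z (Dom C f). Restr F g (s f) = s (f \<cdot>\<^bsub>C\<^esub> g))"

definition sheaf ::
    "('o, 'm, 'e) category_data_scheme \<Rightarrow> ('o \<Rightarrow> 'm set set) \<Rightarrow>
      ('o, 'm, 's, 'p) presheaf_data_scheme \<Rightarrow> bool" where
  "sheaf C J F \<longleftrightarrow> presheaf C F \<and>
    (\<forall>X \<in> Obj C. \<forall>S \<in> J X. \<forall>s. matching_family C F S s \<longrightarrow>
      (\<exists>!x. x \<in> Sections F X \<and> (\<forall>f \<in> S. Restr F f x = s f)))"

end

theory Submission
  imports Defs
begin

text \<open>An effective epimorphism is in particular an epimorphism, so if its target is projective the
  identity of the target lifts along it: it is a split epimorphism. A sieve generated by a split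
  epimorphism contains the identity of the target and is therefore maximal. Hence the effective
  epimorphisms already cover in the trivial topology, whose only covering sieves are the maximal
  ones, and by minimality the regular topology has no other covering sieves. Every presheaf
  is a sheaf for the trivial topology, because a matching family on a maximal sieve is determined
  by, and can be recovered from, its value at the identity.\<close>

context category
begin

text \<open>Two arrows that agree after composition with \<open>f\<close> are both factorisations through \<open>f\<close> of their
  common composite, which respects every relation \<open>f \<cdot> g1 = f \<cdot> g2\<close>; such factorisations are
  unique.\<close>

lemma effective_epimorphism_imp_epimorphism:
  assumes "effective_epimorphism C f"
  shows "epimorphism C f"
  unfolding epimorphism_def
proof (intro conjI allI ballI impI)
  show f: "f \<in> Arr C"
    using assms by (simp add: effective_epimorphism_def)
  then have f_hom: "f \<in> hom_set C (Dom C f) (Cod C f)"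
    by (simp add: hom_set_def)
  fix W a b
  assume a: "a \<in> hom_set C (Cod C f) W" and b: "b \<in> hom_set C (Cod C f) W"
    and eq: "a \<cdot> f = b \<cdot> f"
  have "(a \<cdot> f) \<cdot> g1 = (a \<cdot> f) \<cdot> g2"
    if "g1 \<in> hom_set C Z (Dom C f)" "g2 \<in> hom_set C Z (Dom C f)" "f \<cdot> g1 = f \<cdot> g2" for Z g1 g2
    using that comp_assoc[OF _ f_hom a] by simp
  then have "\<exists>!d. d \<in> hom_set C (Cod C f) W \<and> d \<cdot> f = a \<cdot> f"
    using assms comp_hom[OF f_hom a] unfolding effective_epimorphism_def by blast
  then show "a = b"
    using a b eq by metis
qed

lemma ident_in_maximal_sieve:
  assumes "X \<in> Obj C"
  shows "Ident C X \<in> maximal_sieve C X"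
  using ident_hom[OF assms] by (simp add: maximal_sieve_def hom_set_def)

lemma sieve_with_ident_is_maximal:
  assumes X: "X \<in> Obj C" and S: "sieve C X S" and ident: "Ident C X \<in> S"
  shows "S = maximal_sieve C X"
proof
  show "S \<subseteq> maximal_sieve C X"
    using S by (simp add: sieve_def maximal_sieve_def)
  show "maximal_sieve C X \<subseteq> S"
  proof
    fix f assume "f \<in> maximal_sieve C X"
    then have f: "f \<in> hom_set C (Dom C f) X"
      by (simp add: maximal_sieve_def hom_set_def)
    have "Dom C (Ident C X) = X"
      using ident_hom[OF X] by (simp add: hom_set_def)
    then have "Ident C X \<cdot> f \<in> S"
      using S ident f by (simp add: sieve_def)
    then show "f \<in> S"
      using ident_left[OF f] by simp
  qed
qed

text \<open>Projectivity is applied to the identity of the target; the resulting section exhibits that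
  identity as a member of the generated sieve.\<close>

lemma effective_epimorphism_onto_projective_generates_maximal_sieve:
  assumes f: "effective_epimorphism C f" and proj: "projective C (Cod C f)"
  shows "generated_sieve C f = maximal_sieve C (Cod C f)"
proof -
  have X: "Cod C f \<in> Obj C"
    using proj by (simp add: projective_def)
  obtain s where s: "s \<in> hom_set C (Cod C f) (Dom C f)" and split: "f \<cdot> s = Ident C (Cod C f)"
    using proj effective_epimorphism_imp_epimorphism[OF f] ident_hom[OF X]
    unfolding projective_def by blast
  have "Ident C (Cod C f) \<in> generated_sieve C f"
    unfolding generated_sieve_def using s split[symmetric] by (auto simp: hom_set_def)
  moreover have "sieve C (Cod C f) (generated_sieve C f)"
    using f by (intro sieve_generated_sieve) (simp add: effective_epimorphism_def)
  ultimately show ?thesis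
    using sieve_with_ident_is_maximal[OF X] by blast
qed

lemma pullback_maximal_sieve:
  assumes h: "h \<in> hom_set C Y X"
  shows "pullback_sieve C h (maximal_sieve C X) = maximal_sieve C Y"
proof -
  have "h \<cdot> g \<in> maximal_sieve C X" if "g \<in> Arr C" "Cod C g = Y" for g
    using comp_hom[OF _ h, of g "Dom C g"] that by (simp add: hom_set_def maximal_sieve_def)
  then show ?thesis
    using h by (auto simp: pullback_sieve_def maximal_sieve_def hom_set_def)
qed

lemma grothendieck_topology_maximal_sieves:
  "grothendieck_topology C (\<lambda>X. {maximal_sieve C X})"
  unfolding grothendieck_topology_def
proof (intro conjI ballI allI impI)
  fix X S assume X: "X \<in> Obj C" and "S \<in> {maximal_sieve C X}"
  then have S: "S = maximal_sieve C X" by simp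
  show "sieve C X S"
    unfolding S using grothendieck_topology_all_sieves X by (auto simp: grothendieck_topology_def)
  show "pullback_sieve C h S \<in> {maximal_sieve C Y}" if "h \<in> hom_set C Y X" for Y h
    using pullback_maximal_sieve[OF that] S by simp
  fix R assume R: "sieve C X R"
    and loc: "\<forall>f\<in>S. pullback_sieve C f R \<in> {maximal_sieve C (Dom C f)}"
  \<comment> \<open>Locality at the identity alone suffices: pulling back along it leaves a sieve unchanged.\<close>
  have id: "Ident C X \<in> hom_set C X X"
    using ident_hom[OF X] .
  have "pullback_sieve C (Ident C X) R = maximal_sieve C X"
    using loc ident_in_maximal_sieve[OF X] S id by (auto simp: hom_set_def)
  then have "Ident C X \<in> pullback_sieve C (Ident C X) R"
    using ident_in_maximal_sieve[OF X] by simp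
  then have "Ident C X \<in> R"
    using ident_left[OF id] by (simp add: pullback_sieve_def)
  then show "R \<in> {maximal_sieve C X}"
    using sieve_with_ident_is_maximal[OF X R] by simp
qed simp

text \<open>The functoriality of \<open>F\<close> at identities forces an amalgamation of \<open>s\<close> to be the value of \<open>s\<close> at
  the identity, and the matching condition at the identity shows that this value is one.\<close>

lemma matching_family_on_maximal_sieve_amalgamates:
  assumes F: "presheaf C F" and X: "X \<in> Obj C"
    and s: "matching_family C F (maximal_sieve C X) s"
  shows "\<exists>!x. x \<in> Sections F X \<and> (\<forall>f \<in> maximal_sieve C X. Restr F f x = s f)"
proof (rule ex1I[of _ "s (Ident C X)"])
  have id: "Ident C X \<in> maximal_sieve C X" and dom: "Dom C (Ident C X) = X"
    using ident_in_maximal_sieve[OF X] ident_hom[OF X] by (auto simp: hom_set_def)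
  have "Restr F f (s (Ident C X)) = s f" if "f \<in> maximal_sieve C X" for f
  proof -
    have f: "f \<in> hom_set C (Dom C f) X"
      using that by (simp add: maximal_sieve_def hom_set_def)
    have "Restr F f (s (Ident C X)) = s (Ident C X \<cdot> f)"
      using s id f dom by (auto simp: matching_family_def)
    then show ?thesis
      using ident_left[OF f] by simp
  qed
  moreover have "s (Ident C X) \<in> Sections F X"
    using s id dom by (force simp: matching_family_def)
  ultimately show "s (Ident C X) \<in> Sections F X \<and>
      (\<forall>f \<in> maximal_sieve C X. Restr F f (s (Ident C X)) = s f)"
    by blast
  fix x assume "x \<in> Sections F X \<and> (\<forall>f \<in> maximal_sieve C X. Restr F f x = s f)"
  then show "x = s (Ident C X)"
    using F X id by (auto simp: presheaf_def)
qed

lemma regular_topology_covering_sieve_maximal: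
  assumes proj: "\<forall>P \<in> Obj C. projective C P" and S: "S \<in> regular_topology C X"
  shows "S = maximal_sieve C X"
proof -
  have "effective_epis_cover C (\<lambda>X. {maximal_sieve C X})"
    unfolding effective_epis_cover_def
  proof (intro allI impI)
    fix f assume f: "effective_epimorphism C f"
    then have "projective C (Cod C f)"
      using proj cod_obj by (simp add: effective_epimorphism_def)
    then show "generated_sieve C f \<in> {maximal_sieve C (Cod C f)}"
      using effective_epimorphism_onto_projective_generates_maximal_sieve[OF f] by simp
  qed
  from regular_topology_least[OF grothendieck_topology_maximal_sieves this] S
  show ?thesis by blast
qed

end

theorem proposition6p4:
  fixes C :: "('o, 'm) category_data"
    and F :: "('o, 'm, 's) presheaf_data"
  assumes "preregular_category C"
    and "\<forall>P \<in> Obj C. projective C P"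
    and "presheaf C F"
  shows "sheaf C (regular_topology C) F"
proof -
  interpret preregular_category C
    by (rule assms(1))
  show ?thesis
    unfolding sheaf_def
  proof (intro conjI ballI allI impI)
    show "presheaf C F" by (rule assms(3))
    fix X S s
    assume X: "X \<in> Obj C" and S: "S \<in> regular_topology C X" and s: "matching_family C F S s"
    have "S = maximal_sieve C X"
      using regular_topology_covering_sieve_maximal[OF assms(2) S] .
    then show "\<exists>!x. x \<in> Sections F X \<and> (\<forall>f\<in>S. Restr F f x = s f)"
      using matching_family_on_maximal_sieve_amalgamates[OF assms(3) X] s by simp
  qed
qed

end
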